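(* Let $\Sigma\cup\{\phi\}$ be a finite set of conditional independence and inclusion atoms. If $\Sigma\models\phi$, then $\Sigma\vdash\phi$.
   Context: Teams: for a model $\mathcal{M}$ with domain $M$, a team $X$ is a set of assignments (maps from a common finite set of variables $\mathrm{Dom}(X)$ into $M$). Atoms: $X$ satisfies the conditional independence atom $\vec y\perp_{\vec x}\vec z$ (tuples not necessarily disjoint) iff for all $s,s'\in X$ with $s(\vec x)=s'(\vec x)$ there is $s''\in X$ with $s''(\vec x)=s(\vec x)$, $s''(\vec y)=s(\vec y)$, $s''(\vec z)=s'(\vec z)$; $X$ satisfies the inclusion atom $\vec x\subseteq\vec y$ (tuples of equal length, repetitions allowed) iff for every $s\in X$ there is $s'\in X$ with $s(\vec x)=s'(\vec y)$. $\Sigma\models\phi$ means: for every model $\mathcal{M}$ and team $X$ with all variables of $\Sigma\cup\{\phi\}$ in $\mathrm{Dom}(X)$, if $X$ satisfies every atom of $\Sigma$ then $X$ satisfies $\phi$. Deduction system (besides conjunction introduction and elimination), where $\vec a,\vec b,\vec c,\vec x,\vec y,\vec z$ are tuples of variables: (1) Reflexivity: $\vec x\subseteq\vec x$. (2) Projection and Permutation: from $x_1\ldots x_n\subseteq y_1\ldots y_n$ infer $x_{i_1}\ldots x_{i_k}\subseteq y_{i_1}\ldots y_{i_k}$ for any sequence $i_1,\ldots,i_k$ from $\{1,\ldots,n\}$. (3) Transitivity: from $\vec x\subseteq\vec y$ and $\vec y\subseteq\vec z$ infer $\vec x\subseteq\vec z$. (4) Identity Rule: from $ab\subseteq cc$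 and $\phi$ (for variables $a,b,c$) infer $\phi'$, obtained from $\phi$ by replacing any number of occurrences of $a$ by $b$. (5) Inclusion Introduction: from $\vec a\subseteq\vec b$ infer $\vec a x\subseteq\vec b c$, where $x$ is a new variable. (6) Start Axiom: $\vec a\vec c\subseteq\vec a\vec x\wedge\vec b\perp_{\vec a}\vec x\wedge\vec a\vec x\subseteq\vec a\vec c$, where $\vec x$ is a sequence of pairwise distinct new variables. (7) Chase Rule: from $\vec y\perp_{\vec x}\vec z$, $\vec a\vec b\subseteq\vec x\vec y$ and $\vec a\vec c\subseteq\vec x\vec z$ infer $\vec a\vec b\vec c\subseteq\vec x\vec y\vec z$. (8) Final Rule: from $\vec a\vec c\subseteq\vec a\vec x$, $\vec b\perp_{\vec a}\vec x$ and $\vec a\vec b\vec x\subseteq\vec a\vec b\vec c$ infer $\vec b\perp_{\vec a}\vec c$. The new variables of an application of Inclusion Introduction (resp. Start Axiom) are $x$ (resp. those of $\vec x$). A deduction from $\Sigma$ is a sequence $(\phi_1,\ldots,\phi_n)$ where each $\phi_i$ is an element of $\Sigma$, an instance of Reflexivity or Start Axiom, or follows from formulas of $\Sigma\cup\{\phi_1,\ldots,\phi_{i-1}\}$ by one of the rules, and where, if $\phi_i$ is an instance of Start Axiom or obtained by Inclusion Introduction, its new variables do not appear in $\Sigma\cup\{\phi_1,\ldots,\phi_{i-1}\}$. $\Sigma\vdash\phi$ means there is a deduction $(\phi_1,\ldots,\phi_n)$ from $\Sigma$ with $\phi_n=\phi$ such that no variable of $\phi$ is a new variable of any step. *)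

theory Defs
  imports Main "HOL-Library.FuncSet" "HOL-Library.Infinite_Typeclass"
begin

text \<open>
  \<open>Indep ys xs zs\<close> is the atom stating that \<open>ys\<close> is independent of \<open>zs\<close> given \<open>xs\<close>
  (the conditioning tuple is the middle argument); \<open>Incl xs ys\<close> is the atom
  \<open>xs \<subseteq> ys\<close>. Tuples may be empty, contain repetitions and overlap.
\<close>

datatype (atom_vars: 'v) atom =
    Indep "'v list" "'v list" "'v list"
  | Incl "'v list" "'v list"

fun wf_atom :: "'v atom \<Rightarrow> bool" where
  "wf_atom (Indep ys xs zs) \<longleftrightarrow> True"
| "wf_atom (Incl xs ys) \<longleftrightarrow> length xs = length ys"


definition team :: "'m set \<Rightarrow> 'v set \<Rightarrow> ('v \<Rightarrow> 'm) set \<Rightarrow> bool" where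
  "team M D X \<longleftrightarrow> finite D \<and> X \<subseteq> D \<rightarrow>\<^sub>E M"

fun sat :: "('v \<Rightarrow> 'm) set \<Rightarrow> 'v atom \<Rightarrow> bool" where
  "sat X (Indep ys xs zs) \<longleftrightarrow>
    (\<forall>s\<in>X. \<forall>s'\<in>X. map s xs = map s' xs \<longrightarrow>
      (\<exists>s''\<in>X. map s'' xs = map s xs \<and> map s'' ys = map s ys \<and> map s'' zs = map s' zs))"
| "sat X (Incl xs ys) \<longleftrightarrow> (\<forall>s\<in>X. \<exists>s'\<in>X. map s xs = map s' ys)"

text \<open>
  The atoms mention no symbols of the vocabulary, so a model enters only through its
  nonempty domain \<open>M\<close>, here any nonempty subset of the type \<open>'m\<close>. For an infinite type
  \<open>'m\<close> this coincides with consequence over all models, by the downward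
  Loewenheim-Skolem theorem.
\<close>

definition entails :: "'m itself \<Rightarrow> 'v atom set \<Rightarrow> 'v atom \<Rightarrow> bool" where
  "entails _ \<Sigma> \<phi> \<longleftrightarrow>
    (\<forall>(M :: 'm set) D X.
      M \<noteq> {} \<longrightarrow> team M D X \<longrightarrow> (\<Union>\<psi>\<in>insert \<phi> \<Sigma>. atom_vars \<psi>) \<subseteq> D \<longrightarrow>
      (\<forall>\<psi>\<in>\<Sigma>. sat X \<psi>) \<longrightarrow> sat X \<phi>)"


datatype (fm_vars: 'v) fm =
    Atom "'v atom"
  | And "'v fm" "'v fm"

text \<open>
  \<open>infers G \<phi> N\<close>: from the available formulas \<open>G\<close> one step yields \<open>\<phi>\<close>, with \<open>N\<close> the set of
  new variables of that step. New variables are distinct from those of \<open>G\<close> and also from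
  the variables of the other tuples in the rule instance. The latter is essential: if
  \<open>bs\<close> could share variables with \<open>xs\<close>, then \<open>start_axiom\<close> would give \<open>v\<close> independent of
  itself together with \<open>u \<subseteq> v\<close>, for \<open>v\<close> new and \<open>u\<close> arbitrary, which is unsound.

  The relator \<open>rel_fm\<close> relates formulas of the same shape whose variables at
  corresponding positions are related, so in \<open>identity\<close> each occurrence of \<open>a\<close> may
  independently be kept or replaced by \<open>b\<close>.
\<close>

inductive infers :: "'v fm set \<Rightarrow> 'v fm \<Rightarrow> 'v set \<Rightarrow> bool" for G where
  conj_intro:
    "\<phi> \<in> G \<Longrightarrow> \<psi> \<in> G \<Longrightarrow> infers G (And \<phi> \<psi>) {}"
| conj_elim1:
    "And \<phi> \<psi> \<in> G \<Longrightarrow> infers G \<phi> {}"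
| conj_elim2:
    "And \<phi> \<psi> \<in> G \<Longrightarrow> infers G \<psi> {}"
| reflexivity:
    "infers G (Atom (Incl xs xs)) {}"
| projection:
    "Atom (Incl xs ys) \<in> G \<Longrightarrow> length xs = length ys \<Longrightarrow> set js \<subseteq> {..<length xs} \<Longrightarrow>
     infers G (Atom (Incl (map ((!) xs) js) (map ((!) ys) js))) {}"
| transitivity:
    "Atom (Incl xs ys) \<in> G \<Longrightarrow> Atom (Incl ys zs) \<in> G \<Longrightarrow>
     infers G (Atom (Incl xs zs)) {}"
| identity:
    "Atom (Incl [a, b] [c, c]) \<in> G \<Longrightarrow> \<phi> \<in> G \<Longrightarrow>
     rel_fm (\<lambda>u v. v = u \<or> (u = a \<and> v = b)) \<phi> \<phi>' \<Longrightarrow>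
     infers G \<phi>' {}"
| inclusion_intro:
    "Atom (Incl as bs) \<in> G \<Longrightarrow>
     x \<notin> (\<Union>\<psi>\<in>G. fm_vars \<psi>) \<union> {c} \<Longrightarrow>
     infers G (Atom (Incl (as @ [x]) (bs @ [c]))) {x}"
| start_axiom:
    "length xs = length cs \<Longrightarrow> distinct xs \<Longrightarrow>
     set xs \<inter> ((\<Union>\<psi>\<in>G. fm_vars \<psi>) \<union> set as \<union> set bs \<union> set cs) = {} \<Longrightarrow>
     infers G
       (And (Atom (Incl (as @ cs) (as @ xs)))
         (And (Atom (Indep bs as xs))
           (Atom (Incl (as @ xs) (as @ cs))))) (set xs)"
| chase:
    "Atom (Indep ys xs zs) \<in> G \<Longrightarrow>
     Atom (Incl (as @ bs) (xs @ ys)) \<in> G \<Longrightarrow> Atom (Incl (as @ cs) (xs @ zs)) \<in> G \<Longrightarrow>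
     length as = length xs \<Longrightarrow> length bs = length ys \<Longrightarrow> length cs = length zs \<Longrightarrow>
     infers G (Atom (Incl (as @ bs @ cs) (xs @ ys @ zs))) {}"
| final:
    "Atom (Incl (as @ cs) (as @ xs)) \<in> G \<Longrightarrow> Atom (Indep bs as xs) \<in> G \<Longrightarrow>
     Atom (Incl (as @ bs @ xs) (as @ bs @ cs)) \<in> G \<Longrightarrow>
     infers G (Atom (Indep bs as cs)) {}"

text \<open>
  Each entry of a deduction carries the set of new variables of its step, since a formula
  alone does not determine by which rule it was obtained.
\<close>

definition deduction :: "'v atom set \<Rightarrow> ('v fm \<times> 'v set) list \<Rightarrow> bool" where
  "deduction \<Sigma> ds \<longleftrightarrow>
    (\<forall>i<length ds.
      fst (ds ! i) \<in> Atom ` \<Sigma> \<and> snd (ds ! i) = {} \<or>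
      infers (Atom ` \<Sigma> \<union> fst ` set (take i ds)) (fst (ds ! i)) (snd (ds ! i)))"

definition derives :: "'v atom set \<Rightarrow> 'v atom \<Rightarrow> bool" where
  "derives \<Sigma> \<phi> \<longleftrightarrow>
    (\<exists>ds. deduction \<Sigma> ds \<and> ds \<noteq> [] \<and> fst (last ds) = Atom \<phi> \<and>
      (\<forall>d\<in>set ds. atom_vars \<phi> \<inter> snd d = {}))"

end

theory Submission
  imports Defs "HOL-Library.Countable_Set"
begin

text \<open>
  The countermodel is built from the deduction system itself. Let \<open>d\<close> list the variables of
  \<open>\<Sigma>\<close> and \<open>\<phi>\<close>. A fair infinite deduction yields a set \<open>R\<close> over countably many variables that
  is closed under the inferences of inclusion atoms without new variables and in which every
  \<open>as \<subseteq> bs\<close> extends to some \<open>as us \<subseteq> bs d\<close>. Identify \<open>a\<close> and \<open>b\<close> when some \<open>a b \<subseteq> c c\<close> is in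
  \<open>R\<close>, and let the team consist of the assignments sending \<open>d\<close> to the classes of \<open>t\<close>, for each
  \<open>t \<subseteq> d\<close> in \<open>R\<close>. It satisfies \<open>\<Sigma>\<close>: extension provides the rows demanded by an inclusion atom,
  and the Chase Rule those demanded by an independence atom. So it satisfies \<open>\<phi>\<close>, and the
  witness for the row \<open>d\<close> can be read back as a derivation. If \<open>\<phi>\<close> is an independence atom, the
  deduction begins with the Start Axiom, whose new variables provide the second row.
\<close>

section \<open>Finiteness of variable sets and of premises\<close>

abbreviation vars_of :: "'v fm set \<Rightarrow> 'v set" where
  "vars_of G \<equiv> \<Union>\<psi>\<in>G. fm_vars \<psi>"

lemma finite_atom_vars: "finite (atom_vars \<psi>)"
  by (cases \<psi>) auto

lemma finite_fm_vars: "finite (fm_vars \<psi>)"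
  by (induction \<psi>) (auto simp: finite_atom_vars)

lemma infinite_distinct_list:
  assumes "infinite A"
  obtains xs where "distinct xs" "length xs = n" "set xs \<subseteq> A"
proof -
  obtain B where "finite B" "card B = n" "B \<subseteq> A"
    using infinite_arbitrarily_large[OF assms] by blast
  then show thesis
    using that finite_distinct_list[of B] distinct_card by metis
qed

text \<open>Every rule has at most three premises, and a step without new variables has no freshness
  condition that a larger set could break. This carries an inference from a limit set back to a
  finite stage.\<close>

lemma infers_finite_premises:
  assumes "infers G \<phi> {}"
  shows "\<exists>F. finite F \<and> F \<subseteq> G \<and> (\<forall>H. F \<subseteq> H \<longrightarrow> infers H \<phi> {})"
  using assms
proof cases
  case (conj_intro \<phi> \<psi>)
  then show ?thesis
    by (intro exI[of _ "{\<phi>, \<psi>}"]) (auto intro: infers.conj_intro)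
next
  case (conj_elim1 \<psi>)
  then show ?thesis
    by (intro exI[of _ "{And \<phi> \<psi>}"]) (auto intro: infers.conj_elim1)
next
  case (conj_elim2 \<psi>)
  then show ?thesis
    by (intro exI[of _ "{And \<psi> \<phi>}"]) (auto intro: infers.conj_elim2)
next
  case (reflexivity xs)
  then show ?thesis
    by (intro exI[of _ "{}"]) (auto intro: infers.reflexivity)
next
  case (projection xs ys js)
  then show ?thesis
    by (intro exI[of _ "{Atom (Incl xs ys)}"]) (simp add: infers.projection)
next
  case (transitivity xs ys zs)
  then show ?thesis
    by (intro exI[of _ "{Atom (Incl xs ys), Atom (Incl ys zs)}"]) (auto intro: infers.transitivity)
next
  case (identity a b c \<psi>)
  then show ?thesis
    by (intro exI[of _ "{Atom (Incl [a, b] [c, c]), \<psi>}"]) (auto intro: infers.identity)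
next
  case (start_axiom xs cs as bs)
  \<comment> \<open>The set of new variables is empty, so \<open>xs\<close> and with it
    \<open>cs\<close> are empty.\<close>
  then show ?thesis
    by (intro exI[of _ "{}"]) (auto intro: infers.start_axiom[of "[]" "[]", simplified])
next
  case (chase ys xs zs as bs cs)
  then show ?thesis
    by (intro exI[of _ "{Atom (Indep ys xs zs), Atom (Incl (as @ bs) (xs @ ys)),
          Atom (Incl (as @ cs) (xs @ zs))}"]) (auto intro: infers.chase)
next
  case (final as cs xs bs)
  then show ?thesis
    by (intro exI[of _ "{Atom (Incl (as @ cs) (as @ xs)), Atom (Indep bs as xs),
          Atom (Incl (as @ bs @ xs) (as @ bs @ cs))}"]) (auto intro: infers.final)
qed simp


subsection \<open>Deductions as sequences of formula sets\<close>

text \<open>A deduction reduced to its growing set of available formulas. \<open>D\<close> holds the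
  variables that no step may introduce as new.\<close>

inductive extends :: "'v set \<Rightarrow> 'v fm set \<Rightarrow> 'v fm set \<Rightarrow> bool" for D where
  self: "extends D G G"
| step: "extends D G H \<Longrightarrow> infers H \<phi> N \<Longrightarrow> N \<inter> D = {} \<Longrightarrow> extends D G (insert \<phi> H)"

lemma extends_trans: "extends D H K \<Longrightarrow> extends D G H \<Longrightarrow> extends D G K"
  by (induction rule: extends.induct) (auto intro: extends.intros)

lemma extends_step: "infers G \<phi> N \<Longrightarrow> N \<inter> D = {} \<Longrightarrow> extends D G (insert \<phi> G)"
  by (auto intro: extends.intros)

lemma extends_subset: "extends D G H \<Longrightarrow> G \<subseteq> H"
  by (induction rule: extends.induct) auto

lemma deduction_append1:
  assumes "deduction \<Sigma> ds" "infers (Atom ` \<Sigma> \<union> fst ` set ds) \<phi> N"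
  shows "deduction \<Sigma> (ds @ [(\<phi>, N)])"
  using assms by (auto simp: deduction_def nth_append less_Suc_eq)

lemma extends_imp_deduction:
  assumes "extends D G H" "G = Atom ` \<Sigma>"
  shows "\<exists>ds. deduction \<Sigma> ds \<and> H = Atom ` \<Sigma> \<union> fst ` set ds \<and> (\<forall>d\<in>set ds. snd d \<inter> D = {})"
  using assms
proof (induction rule: extends.induct)
  case (self G)
  then show ?case
    by (intro exI[of _ "[]"]) (auto simp: deduction_def)
next
  case (step G H \<phi> N)
  then obtain ds where "deduction \<Sigma> ds" "H = Atom ` \<Sigma> \<union> fst ` set ds"
    "\<forall>d\<in>set ds. snd d \<inter> D = {}"
    by blast
  with step show ?case
    by (intro exI[of _ "ds @ [(\<phi>, N)]"]) (auto intro: deduction_append1)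
qed

text \<open>A deduction must end in its conclusion, while a formula set has no last element; hence
  the inference of \<open>\<phi>\<close> is appended as a separate last step.\<close>

lemma derives_if_extends:
  assumes "extends D (Atom ` \<Sigma>) H" "infers H (Atom \<phi>) {}" "atom_vars \<phi> \<subseteq> D"
  shows "derives \<Sigma> \<phi>"
proof -
  obtain ds where ds: "deduction \<Sigma> ds" "H = Atom ` \<Sigma> \<union> fst ` set ds"
    "\<forall>d\<in>set ds. snd d \<inter> D = {}"
    using extends_imp_deduction[OF assms(1) refl] by blast
  then show ?thesis
    unfolding derives_def using assms(2,3)
    by (intro exI[of _ "ds @ [(Atom \<phi>, {})]"]) (auto intro: deduction_append1)
qed


subsection \<open>Saturation\<close>

text \<open>Inclusion Introduction is iterated, once per entry of \<open>cs\<close>. Only finitely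
  many variables lie in \<open>G\<close> or \<open>D\<close>, so \<open>V\<close> always has a fresh
  one.\<close>

lemma inclusion_intro_list:
  assumes "infinite V" "finite D" "set cs \<subseteq> V"
    and "Atom (Incl as bs) \<in> G" "finite G" "vars_of G \<subseteq> V"
  shows "\<exists>us H. length us = length cs \<and> extends D G H \<and> finite H \<and> vars_of H \<subseteq> V \<and>
    Atom (Incl (as @ us) (bs @ cs)) \<in> H"
  using assms(3-)
proof (induction cs arbitrary: as bs G)
  case Nil
  then show ?case
    by (intro exI[of _ "[]"] exI[of _ G]) (auto intro: extends.self)
next
  case (Cons c cs)
  have "finite (vars_of G \<union> {c} \<union> D)"
    using Cons.prems assms(2) by (auto simp: finite_fm_vars)
  then have "V - (vars_of G \<union> {c} \<union> D) \<noteq> {}"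
    using assms(1) by (metis Diff_infinite_finite finite.emptyI)
  then obtain x where x: "x \<in> V" "x \<notin> vars_of G \<union> {c}" "x \<notin> D"
    by blast
  let ?\<psi> = "Atom (Incl (as @ [x]) (bs @ [c]))"
  have ext: "extends D G (insert ?\<psi> G)"
    using x Cons.prems by (intro extends_step[OF infers.inclusion_intro]) auto
  have "fm_vars (Atom (Incl as bs)) \<subseteq> V"
    using Cons.prems by blast
  then have "vars_of (insert ?\<psi> G) \<subseteq> V"
    using x Cons.prems by auto
  then obtain us H where "length us = length cs" "extends D (insert ?\<psi> G) H" "finite H"
    "vars_of H \<subseteq> V" "Atom (Incl ((as @ [x]) @ us) ((bs @ [c]) @ cs)) \<in> H"
    using Cons.IH[of "as @ [x]" "bs @ [c]" "insert ?\<psi> G"] Cons.prems by auto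
  then show ?case
    using ext by (intro exI[of _ "x # us"] exI[of _ H]) (auto intro: extends_trans)
qed

text \<open>Closure concerns only inclusion atoms over \<open>V\<close>, so that there are countably
  many to treat when \<open>V\<close> is countable. By \<open>extend\<close> the right side can be
  made to end in all of \<open>d\<close>, which supplies a full row.\<close>

locale saturated =
  fixes d :: "'v list" and V :: "'v set" and R :: "'v fm set"
  assumes vars_d: "set d \<subseteq> V"
    and vars_R: "vars_of R \<subseteq> V"
    and closed: "infers R (Atom (Incl as bs)) {} \<Longrightarrow> set as \<subseteq> V \<Longrightarrow> set bs \<subseteq> V \<Longrightarrow>
      Atom (Incl as bs) \<in> R"
    and extend: "Atom (Incl as bs) \<in> R \<Longrightarrow> length as = length bs \<Longrightarrow>
      \<exists>us. length us = length d \<and> Atom (Incl (as @ us) (bs @ d)) \<in> R"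

text \<open>Finite stages each treat one pair of tuples over \<open>V\<close>, and \<open>R\<close>
  is their union. The last conclusion keeps contact with deductions, as a finite part of
  \<open>R\<close> lies in a single stage.\<close>

lemma saturation:
  assumes V: "infinite V" "countable V" "finite D" "set d \<subseteq> V"
    and G: "finite G" "vars_of G \<subseteq> V"
  obtains R where "saturated d V R" "G \<subseteq> R"
    "\<And>F. finite F \<Longrightarrow> F \<subseteq> R \<Longrightarrow> \<exists>H. extends D G H \<and> F \<subseteq> H"
proof -
  define T where "T = lists V \<times> lists V"
  have T: "countable T" "T \<noteq> {}"
    using V by (auto simp: T_def)
  \<comment> \<open>Only the second component of the decoded \<open>n\<close> counts, so each pair
    of tuples recurs at infinitely many stages.\<close>
  define task where "task n = from_nat_into T (snd (prod_decode n))" for n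
  have task: "task n \<in> T" for n
    by (simp add: task_def T from_nat_into)
  define good where "good H \<longleftrightarrow> finite H \<and> vars_of H \<subseteq> V \<and> extends D G H" for H
  define handles where "handles as bs H H' \<longleftrightarrow> extends D H H' \<and> (infers H (Atom (Incl as bs)) {} \<longrightarrow>
    Atom (Incl as bs) \<in> H' \<and> (\<exists>us. length us = length d \<and> Atom (Incl (as @ us) (bs @ d)) \<in> H'))"
    for as bs H H'
  have next_set: "\<exists>H'. good H' \<and> handles as bs H H'"
    if H: "good H" and t: "(as, bs) \<in> T" for as bs H
  proof (cases "infers H (Atom (Incl as bs)) {}")
    case True
    let ?H = "insert (Atom (Incl as bs)) H"
    have ext: "extends D H ?H"
      using True by (intro extends_step) auto
    have "finite ?H" "vars_of ?H \<subseteq> V"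
      using H t by (auto simp: good_def T_def in_lists_conv_set)
    then obtain us H' where H': "length us = length d" "extends D ?H H'" "finite H'"
      "vars_of H' \<subseteq> V" "Atom (Incl (as @ us) (bs @ d)) \<in> H'"
      using inclusion_intro_list[of V D d as bs ?H] V by blast
    moreover have "extends D H H'"
      using ext H'(2) extends_trans by blast
    ultimately show ?thesis
      using H extends_subset[OF H'(2)] unfolding good_def handles_def
      by (metis extends_trans insert_subset)
  next
    case False
    then show ?thesis
      using H by (auto simp: handles_def intro: extends.self)
  qed
  have "good G"
    using G by (simp add: good_def extends.self)
  then have "\<exists>f. f 0 = G \<and> (\<forall>n. good (f n)) \<and>
      (\<forall>n. handles (fst (task n)) (snd (task n)) (f n) (f (Suc n)))"
  proof -
    have "\<exists>f. \<forall>n. (good (f n) \<and> (n = 0 \<longrightarrow> f n = G)) \<and>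
        handles (fst (task n)) (snd (task n)) (f n) (f (Suc n))"
    proof (rule dependent_nat_choice)
      show "\<exists>H. good H \<and> (0 = (0::nat) \<longrightarrow> H = G)"
        using \<open>good G\<close> by blast
      show "\<exists>H'. (good H' \<and> (Suc n = 0 \<longrightarrow> H' = G)) \<and> handles (fst (task n)) (snd (task n)) H H'"
        if "good H \<and> (n = 0 \<longrightarrow> H = G)" for H n
        using next_set[of H "fst (task n)" "snd (task n)"] task[of n] that by auto
    qed
    then show ?thesis
      by blast
  qed
  then obtain f where f: "f 0 = G" "\<And>n. good (f n)"
    "\<And>n. handles (fst (task n)) (snd (task n)) (f n) (f (Suc n))"
    by blast
  have mono: "f m \<subseteq> f n" if "m \<le> n" for m n
    using that f(3) lift_Suc_mono_le[of f m n] extends_subset unfolding handles_def by blast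
  define R where "R = (\<Union>n. f n)"
  have finite_R: "\<exists>m. F \<subseteq> f m" if "finite F" "F \<subseteq> R" for F
    using that
  proof (induction rule: finite_induct)
    case (insert \<psi> F)
    then obtain m k where "F \<subseteq> f m" "\<psi> \<in> f k"
      unfolding R_def by auto
    then have "insert \<psi> F \<subseteq> f (max m k)"
      using mono[of m "max m k"] mono[of k "max m k"] by auto
    then show ?case
      by blast
  qed auto
  have handled: "Atom (Incl as bs) \<in> R \<and>
      (\<exists>us. length us = length d \<and> Atom (Incl (as @ us) (bs @ d)) \<in> R)"
    if inf: "infers R (Atom (Incl as bs)) {}" and "set as \<subseteq> V" "set bs \<subseteq> V" for as bs
  proof -
    obtain F where F: "finite F" "F \<subseteq> R" "\<And>H. F \<subseteq> H \<Longrightarrow> infers H (Atom (Incl as bs)) {}"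
      using infers_finite_premises[OF inf] by blast
    obtain m where m: "F \<subseteq> f m"
      using finite_R F by blast
    \<comment> \<open>Pairing with \<open>m\<close> makes \<open>n\<close> at least
      \<open>m\<close>, so the premises \<open>F\<close> are present when \<open>(as, bs)\<close> is
      treated.\<close>
    define n where "n = prod_encode (m, to_nat_on T (as, bs))"
    have "(as, bs) \<in> T"
      using that by (auto simp: T_def in_lists_conv_set)
    then have "task n = (as, bs)"
      using T by (simp add: task_def n_def)
    moreover have "F \<subseteq> f n"
      using m mono[of m n] by (auto simp: n_def le_prod_encode_1)
    ultimately have "Atom (Incl as bs) \<in> f (Suc n)"
      "\<exists>us. length us = length d \<and> Atom (Incl (as @ us) (bs @ d)) \<in> f (Suc n)"
      using f(3)[of n] F(3)[of "f n"] by (simp_all add: handles_def)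
    then show ?thesis
      unfolding R_def by blast
  qed
  have "saturated d V R"
  proof
    show "set d \<subseteq> V"
      by (fact V)
    show R_V: "vars_of R \<subseteq> V"
      using f(2) by (force simp: R_def good_def)
    show "Atom (Incl as bs) \<in> R"
      if "infers R (Atom (Incl as bs)) {}" "set as \<subseteq> V" "set bs \<subseteq> V" for as bs
      using handled that by blast
    show "\<exists>us. length us = length d \<and> Atom (Incl (as @ us) (bs @ d)) \<in> R"
      if "Atom (Incl as bs) \<in> R" "length as = length bs" for as bs
    proof -
      have "fm_vars (Atom (Incl as bs)) \<subseteq> V"
        using that R_V by blast
      then have "set as \<subseteq> V" "set bs \<subseteq> V"
        by auto
      \<comment> \<open>Projection along all positions in order returns the atom itself, so
        \<open>handled\<close> also covers members of \<open>R\<close>.\<close>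
      moreover have "infers R (Atom (Incl as bs)) {}"
        using infers.projection[of as bs R "[0..<length as]"] that
        by (simp add: map_nth atLeast0LessThan) (metis map_nth)
      ultimately show ?thesis
        using handled by blast
    qed
  qed
  moreover have "G \<subseteq> R"
    using f(1) by (auto simp: R_def)
  moreover have "\<exists>H. extends D G H \<and> F \<subseteq> H" if "finite F" "F \<subseteq> R" for F
    using finite_R[OF that] f(2) by (auto simp: good_def)
  ultimately show thesis
    using that by blast
qed


subsection \<open>The canonical team\<close>

lemma list_all2_refl': "(\<And>x. x \<in> set xs \<Longrightarrow> P x x) \<Longrightarrow> list_all2 P xs xs"
  by (simp add: list_all2_same)

context saturated
begin

lemma incl_vars: "Atom (Incl as bs) \<in> R \<Longrightarrow> set as \<subseteq> V \<and> set bs \<subseteq> V"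
  using vars_R by fastforce

lemma reflexivity: "set as \<subseteq> V \<Longrightarrow> Atom (Incl as as) \<in> R"
  by (simp add: closed infers.reflexivity)

lemma projection:
  assumes R: "Atom (Incl as bs) \<in> R" "length as = length bs" and js: "set js \<subseteq> {..<length as}"
  shows "Atom (Incl (map ((!) as) js) (map ((!) bs) js)) \<in> R"
proof (rule closed[OF infers.projection[OF R js]])
  have "as ! j \<in> set as" "bs ! j \<in> set bs" if "j \<in> set js" for j
    using that js R(2) by auto
  then show "set (map ((!) as) js) \<subseteq> V" "set (map ((!) bs) js) \<subseteq> V"
    using incl_vars[OF R(1)] by auto
qed

lemma transitivity:
  "Atom (Incl as bs) \<in> R \<Longrightarrow> Atom (Incl bs cs) \<in> R \<Longrightarrow> Atom (Incl as cs) \<in> R"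
  using incl_vars by (meson closed infers.transitivity)

text \<open>\<open>a b \<subseteq> c c\<close> forces \<open>a\<close> and \<open>b\<close> to agree
  in every assignment of a team: this is equality as far as \<open>R\<close> establishes it.\<close>

definition equ :: "'v \<Rightarrow> 'v \<Rightarrow> bool" (infix \<open>\<approx>\<close> 50) where
  "a \<approx> b \<longleftrightarrow> (\<exists>c. Atom (Incl [a, b] [c, c]) \<in> R)"

lemma equ_vars: "a \<approx> b \<Longrightarrow> a \<in> V \<and> b \<in> V"
  using incl_vars by (fastforce simp: equ_def)

lemma equ_refl: "a \<in> V \<Longrightarrow> a \<approx> a"
  using reflexivity[of "[a, a]"] by (auto simp: equ_def)

lemma equ_sym: "a \<approx> b \<Longrightarrow> b \<approx> a"
  using projection[of "[a, b]" "[c, c]" "[1, 0]" for c] by (auto simp: equ_def)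

text \<open>The entries are exchanged from left to right by the Identity Rule; \<open>ps\<close>
  collects those already done.\<close>

lemma identity:
  assumes "Atom (Incl (ps @ as) bs) \<in> R" "list_all2 (\<approx>) as as'"
  shows "Atom (Incl (ps @ as') bs) \<in> R"
  using assms(2,1)
proof (induction as as' arbitrary: ps rule: list_all2_induct)
  case (Cons a as a' as')
  then obtain c where c: "Atom (Incl [a, a'] [c, c]) \<in> R"
    by (auto simp: equ_def)
  have "infers R (Atom (Incl (ps @ a' # as) bs)) {}"
    by (rule infers.identity[OF c Cons.prems])
       (auto intro!: list_all2_appendI list_all2_refl')
  then have "Atom (Incl ((ps @ [a']) @ as) bs) \<in> R"
    using incl_vars[OF c] incl_vars[OF Cons.prems] by (auto intro!: closed)
  then show ?case
    using Cons.IH[of "ps @ [a']"] by simp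
qed simp

lemma equ_trans: "a \<approx> b \<Longrightarrow> b \<approx> c \<Longrightarrow> a \<approx> c"
  using identity[of "[a]" "[b]" "[e, e]" "[c]" for e] by (auto simp: equ_def)

text \<open>\<open>d\<close> may have repetitions: any position of \<open>v\<close> will do.\<close>

definition row :: "'v list \<Rightarrow> 'v \<Rightarrow> 'v" where
  "row t v = t ! (SOME i. i < length d \<and> d ! i = v)"

lemma row_pos:
  assumes "v \<in> set d"
  obtains i where "i < length d" "d ! i = v" "\<And>t. row t v = t ! i"
proof -
  let ?i = "SOME i. i < length d \<and> d ! i = v"
  have "?i < length d \<and> d ! ?i = v"
    by (rule someI_ex) (use assms in \<open>auto simp: in_set_conv_nth\<close>)
  then show thesis
    using that[of ?i] by (simp add: row_def)
qed

lemma row_d: "set xs \<subseteq> set d \<Longrightarrow> map (row d) xs = xs"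
  by (rule map_idI) (metis row_pos subsetD)

definition rows :: "'v list set" where
  "rows = {t. length t = length d \<and> Atom (Incl t d) \<in> R}"

text \<open>This is the identity assignment, the row at which satisfaction is later read back as
  membership in \<open>R\<close>.\<close>

lemma d_in_rows: "d \<in> rows"
  by (simp add: rows_def reflexivity vars_d)

lemma row_vars: "t \<in> rows \<Longrightarrow> v \<in> set d \<Longrightarrow> row t v \<in> V"
  using incl_vars[of t d] by (force simp: rows_def elim: row_pos)

lemma row_project:
  assumes "t \<in> rows" "set xs \<subseteq> set d"
  shows "Atom (Incl (map (row t) xs) xs) \<in> R"
proof -
  \<comment> \<open>The same choice of positions as in \<open>row\<close>, so that projecting
    \<open>t\<close> to them gives the values of \<open>row t\<close>.\<close>
  define pos where "pos v = (SOME i. i < length d \<and> d ! i = v)" for v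
  have pos: "pos v < length d \<and> d ! pos v = v" if "v \<in> set xs" for v
  proof -
    have "v \<in> set d"
      using assms(2) that by blast
    then show ?thesis
      unfolding pos_def in_set_conv_nth by (rule someI_ex)
  qed
  have "map ((!) t) (map pos xs) = map (row t) xs"
    by (simp add: row_def pos_def)
  moreover have "map ((!) d) (map pos xs) = xs"
    using pos by (simp add: map_idI)
  moreover have "Atom (Incl (map ((!) t) (map pos xs)) (map ((!) d) (map pos xs))) \<in> R"
    using assms(1) pos by (intro projection) (auto simp: rows_def)
  ultimately show ?thesis
    by (simp only:)
qed

text \<open>In an extension \<open>as us \<subseteq> bs d\<close>, the part \<open>us\<close> is a
  row. Each entry of \<open>bs\<close> recurs in \<open>d\<close>, and projecting to both places
  gives an atom with one variable twice on the right, as \<approx> requires.\<close>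

lemma row_extend:
  assumes R: "Atom (Incl as bs) \<in> R" "length as = length bs" and bs: "set bs \<subseteq> set d"
  shows "\<exists>u\<in>rows. list_all2 (\<approx>) as (map (row u) bs)"
proof -
  obtain us where us: "length us = length d" "Atom (Incl (as @ us) (bs @ d)) \<in> R"
    using extend[OF R] by blast
  have proj: "Atom (Incl (map ((!) (as @ us)) js) (map ((!) (bs @ d)) js)) \<in> R"
    if "set js \<subseteq> {..<length as + length d}" for js
    using projection[OF us(2)] R(2) us(1) that by simp
  let ?js = "[length as..<length as + length d]"
  have "map ((!) (as @ us)) ?js = us" "map ((!) (bs @ d)) ?js = d"
    using us(1) R(2) by (auto intro!: nth_equalityI simp: nth_append)
  moreover have "set ?js \<subseteq> {..<length as + length d}"
    by auto
  ultimately have "us \<in> rows"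
    using proj[of ?js] us(1) by (simp add: rows_def)
  moreover have "as ! i \<approx> row us (bs ! i)" if i: "i < length as" for i
  proof -
    obtain k where k: "k < length d" "d ! k = bs ! i" "row us (bs ! i) = us ! k"
      using row_pos[of "bs ! i"] bs i R(2) by (metis nth_mem subsetD)
    then show ?thesis
      using proj[of "[i, length as + k]"] i R(2) us(1) by (auto simp: equ_def nth_append)
  qed
  ultimately show ?thesis
    using R(2) by (auto simp: list_all2_conv_all_nth)
qed

text \<open>Places the classes in the infinite type \<open>'m\<close> of the countermodel: a chosen
  representative is numbered, and an injection from \<open>nat\<close> is applied.\<close>

lemma equ_classes:
  assumes "countable V"
  obtains f :: "'v \<Rightarrow> 'm::infinite" where "\<And>a b. a \<in> V \<Longrightarrow> b \<in> V \<Longrightarrow> f a = f b \<longleftrightarrow> a \<approx> b"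
proof -
  obtain g :: "nat \<Rightarrow> 'm" where g: "inj g"
    using infinite_countable_subset[OF infinite_UNIV] by blast
  define rep where "rep a = (SOME b. a \<approx> b)" for a
  have rep: "a \<approx> rep a" if "a \<in> V" for a
    unfolding rep_def using equ_refl[OF that] by (rule someI)
  have "g (to_nat_on V (rep a)) = g (to_nat_on V (rep b)) \<longleftrightarrow> a \<approx> b" if "a \<in> V" "b \<in> V" for a b
  proof -
    have "g (to_nat_on V (rep a)) = g (to_nat_on V (rep b)) \<longleftrightarrow> rep a = rep b"
      using g assms rep that equ_vars by (metis injD to_nat_on_inj)
    also have "\<dots> \<longleftrightarrow> a \<approx> b"
    proof
      show "a \<approx> b" if "rep a = rep b"
        using that rep \<open>a \<in> V\<close> \<open>b \<in> V\<close> by (metis equ_sym equ_trans)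
      show "rep a = rep b" if "a \<approx> b"
      proof -
        \<comment> \<open>Equal predicates make \<open>SOME\<close> pick the same
          representative.\<close>
        have "(\<approx>) a = (\<approx>) b"
          using that by (intro ext) (blast intro: equ_sym equ_trans)
        then show ?thesis
          by (simp add: rep_def)
      qed
    qed
    finally show ?thesis .
  qed
  then show thesis
    using that[of "\<lambda>a. g (to_nat_on V (rep a))"] by blast
qed

definition canonical_team :: "('v \<Rightarrow> 'm) \<Rightarrow> ('v \<Rightarrow> 'm) set" where
  "canonical_team f = (\<lambda>t. restrict (f \<circ> row t) (set d)) ` rows"

lemma team_canonical_team: "team UNIV (set d) (canonical_team f)"
  by (auto simp: team_def canonical_team_def)

end

section \<open>Satisfaction in the canonical team and membership in \<open>R\<close>\<close>

locale canonical = saturated d V R for d :: "'v list" and V R +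
  fixes f :: "'v \<Rightarrow> 'm"
  assumes f: "\<And>a b. a \<in> V \<Longrightarrow> b \<in> V \<Longrightarrow> f a = f b \<longleftrightarrow> a \<approx> b"
begin

lemma map_eq_iff:
  assumes "t \<in> rows" "u \<in> rows" "set xs \<subseteq> set d" "set ys \<subseteq> set d"
  shows "map (restrict (f \<circ> row t) (set d)) xs = map (restrict (f \<circ> row u) (set d)) ys \<longleftrightarrow>
    list_all2 (\<approx>) (map (row t) xs) (map (row u) ys)"
proof -
  have xs: "xs ! i \<in> set d" if "i < length xs" for i
    using assms(3) that nth_mem by blast
  have ys: "ys ! i \<in> set d" if "i < length ys" for i
    using assms(4) that nth_mem by blast
  have "f (row t (xs ! i)) = f (row u (ys ! i)) \<longleftrightarrow> row t (xs ! i) \<approx> row u (ys ! i)"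
    if "i < length xs" "i < length ys" for i
    using xs ys assms(1,2) that by (intro f row_vars) auto
  then show ?thesis
    using xs ys by (auto simp: list_all2_conv_all_nth list_eq_iff_nth_eq)
qed

lemma sat_Incl:
  assumes "set xs \<subseteq> set d" "set ys \<subseteq> set d"
  shows "sat (canonical_team f) (Incl xs ys) \<longleftrightarrow>
    (\<forall>t\<in>rows. \<exists>u\<in>rows. list_all2 (\<approx>) (map (row t) xs) (map (row u) ys))"
  using assms by (simp add: canonical_team_def map_eq_iff)

lemma sat_Indep:
  assumes "set xs \<subseteq> set d" "set ys \<subseteq> set d" "set zs \<subseteq> set d"
  shows "sat (canonical_team f) (Indep ys xs zs) \<longleftrightarrow>
    (\<forall>t\<in>rows. \<forall>t'\<in>rows. list_all2 (\<approx>) (map (row t) xs) (map (row t') xs) \<longrightarrow>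
      (\<exists>u\<in>rows. list_all2 (\<approx>) (map (row u) xs) (map (row t) xs) \<and>
        list_all2 (\<approx>) (map (row u) ys) (map (row t) ys) \<and>
        list_all2 (\<approx>) (map (row u) zs) (map (row t') zs)))"
  using assms by (simp add: canonical_team_def map_eq_iff del: map_eq_conv cong del: imp_cong)

lemma list_equ_sym: "list_all2 (\<approx>) as bs \<Longrightarrow> list_all2 (\<approx>) bs as"
  by (auto simp: list_all2_conv_all_nth intro: equ_sym)

lemma list_equ_trans: "list_all2 (\<approx>) as bs \<Longrightarrow> list_all2 (\<approx>) bs cs \<Longrightarrow> list_all2 (\<approx>) as cs"
  by (erule (1) list_all2_trans[rotated 1]) (rule equ_trans)

text \<open>Transitivity applies an inclusion atom to a projected row, and the Chase Rule applies an
  independence atom to two; \<open>row_extend\<close> turns the resulting atom into the row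
  demanded.\<close>

lemma sat_if_mem:
  assumes "Atom \<psi> \<in> R" "wf_atom \<psi>" "atom_vars \<psi> \<subseteq> set d"
  shows "sat (canonical_team f) \<psi>"
proof (cases \<psi>)
  case (Incl xs ys)
  have "\<exists>u\<in>rows. list_all2 (\<approx>) (map (row t) xs) (map (row u) ys)" if "t \<in> rows" for t
    using assms that Incl row_extend transitivity row_project
    by (metis Un_subset_iff atom.set(2) length_map wf_atom.simps(2))
  then show ?thesis
    using assms Incl sat_Incl by auto
next
  case (Indep ys xs zs)
  then have sub: "set xs \<subseteq> set d" "set ys \<subseteq> set d" "set zs \<subseteq> set d"
    using assms by auto
  have "\<exists>u\<in>rows. list_all2 (\<approx>) (map (row u) xs) (map (row t) xs) \<and>
        list_all2 (\<approx>) (map (row u) ys) (map (row t) ys) \<and>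
        list_all2 (\<approx>) (map (row u) zs) (map (row t') zs)"
    if t: "t \<in> rows" "t' \<in> rows" and eq: "list_all2 (\<approx>) (map (row t) xs) (map (row t') xs)" for t t'
  proof -
    have y: "Atom (Incl (map (row t) xs @ map (row t) ys) (xs @ ys)) \<in> R"
      using row_project[OF t(1), of "xs @ ys"] sub by simp
    have z: "Atom (Incl (map (row t') xs @ map (row t') zs) (xs @ zs)) \<in> R"
      using row_project[OF t(2), of "xs @ zs"] sub by simp
    have refl: "list_all2 (\<approx>) (map (row t') zs) (map (row t') zs)"
      using t sub by (auto intro!: list_all2_refl' equ_refl row_vars)
    \<comment> \<open>The Chase Rule needs the same tuple in front of both premises, so the values
      of \<open>t'\<close> on \<open>xs\<close> are exchanged for the equivalent ones of
      \<open>t\<close>.\<close>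
    have z': "Atom (Incl (map (row t) xs @ map (row t') zs) (xs @ zs)) \<in> R"
      using identity[of "[]", simplified, OF z] list_all2_appendI[OF list_equ_sym[OF eq] refl] by blast
    have "infers R (Atom (Incl (map (row t) xs @ map (row t) ys @ map (row t') zs) (xs @ ys @ zs))) {}"
      using assms(1) Indep by (intro infers.chase y z') auto
    then have "Atom (Incl (map (row t) xs @ map (row t) ys @ map (row t') zs) (xs @ ys @ zs)) \<in> R"
      using incl_vars[OF y] incl_vars[OF z] by (intro closed) auto
    from row_extend[OF this] sub obtain u where "u \<in> rows"
      "list_all2 (\<approx>) (map (row t) xs @ map (row t) ys @ map (row t') zs) (map (row u) (xs @ ys @ zs))"
      by auto
    then show ?thesis
      by (auto simp: list_all2_append intro!: bexI[of _ u] list_equ_sym)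
  qed
  then show ?thesis
    unfolding Indep sat_Indep[OF sub] by blast
qed

text \<open>At the row \<open>d\<close> there is a row \<open>u\<close> whose values on
  \<open>ys\<close> are equivalent to \<open>xs\<close>; the Identity Rule puts \<open>xs\<close> in
  their place in the projection of \<open>u\<close>.\<close>

lemma sat_Incl_imp_mem:
  assumes "sat (canonical_team f) (Incl xs ys)" "set xs \<subseteq> set d" "set ys \<subseteq> set d"
  shows "Atom (Incl xs ys) \<in> R"
proof -
  obtain u where u: "u \<in> rows" "list_all2 (\<approx>) xs (map (row u) ys)"
    using assms d_in_rows sat_Incl row_d by metis
  then show ?thesis
    using identity[of "[]" "map (row u) ys" ys xs] row_project[OF u(1) assms(3)] list_equ_sym by simp
qed

text \<open>The given atom yields a row \<open>t\<close> that, up to \<approx>, agrees with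
  \<open>d\<close> on \<open>as\<close> and has values \<open>xs\<close> on \<open>cs\<close>.
  Independence merges \<open>d\<close> and \<open>t\<close> into a row with values
  \<open>as\<close>, \<open>bs\<close>, \<open>xs\<close>, whose projection is the claim.\<close>

lemma sat_Indep_imp_mem:
  assumes sat: "sat (canonical_team f) (Indep bs as cs)"
    and sub: "set as \<subseteq> set d" "set bs \<subseteq> set d" "set cs \<subseteq> set d"
    and xs: "Atom (Incl (as @ xs) (as @ cs)) \<in> R" "length xs = length cs"
  shows "Atom (Incl (as @ bs @ xs) (as @ bs @ cs)) \<in> R"
proof -
  obtain t where t: "t \<in> rows" "list_all2 (\<approx>) (as @ xs) (map (row t) as @ map (row t) cs)"
    using row_extend[OF xs(1)] xs(2) sub by auto
  then have t': "list_all2 (\<approx>) as (map (row t) as)" "list_all2 (\<approx>) xs (map (row t) cs)"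
    by (auto simp: list_all2_append)
  then obtain u where u: "u \<in> rows" "list_all2 (\<approx>) (map (row u) as) as"
    "list_all2 (\<approx>) (map (row u) bs) bs" "list_all2 (\<approx>) (map (row u) cs) (map (row t) cs)"
    using sat d_in_rows t(1) unfolding sat_Indep[OF sub] by (metis row_d sub(1,2))
  have "list_all2 (\<approx>) (map (row u) cs) xs"
    using u(4) t'(2) list_equ_sym list_equ_trans by blast
  then have "list_all2 (\<approx>) (map (row u) (as @ bs @ cs)) (as @ bs @ xs)"
    using u by (simp add: list_all2_appendI)
  then show ?thesis
    using identity[of "[]"] row_project[OF u(1), of "as @ bs @ cs"] sub by simp
qed

end


section \<open>Completeness: reading a deduction off the canonical team\<close>

theorem theorem12:
  fixes \<Sigma> :: "'v::infinite atom set" and \<phi> :: "'v atom"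
  assumes "finite \<Sigma>"
    and "\<forall>\<psi>\<in>insert \<phi> \<Sigma>. wf_atom \<psi>"
    and "entails TYPE('m::infinite) \<Sigma> \<phi>"
  shows "derives \<Sigma> \<phi>"
proof -
  define D where "D = (\<Union>\<psi>\<in>insert \<phi> \<Sigma>. atom_vars \<psi>)"
  have "finite D"
    using assms(1) by (auto simp: D_def finite_atom_vars)
  then obtain d where d: "set d = D"
    using finite_list by blast
  obtain g :: "nat \<Rightarrow> 'v" where g: "inj g"
    using infinite_countable_subset[OF infinite_UNIV] by blast
  \<comment> \<open>\<open>'v\<close> may be uncountable, while saturation enumerates all tuples
    over \<open>V\<close>; \<open>range g\<close> provides infinitely many variables.\<close>
  define V where "V = D \<union> range g"
  have V: "countable V" "infinite V" "D \<subseteq> V"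
    using \<open>finite D\<close> g by (auto simp: V_def countable_finite finite_image_iff)
  \<comment> \<open>\<open>G\<close> is kept general because the independence case first adds an
    instance of the Start Axiom.\<close>
  have saturated_sat: "\<exists>R (f :: 'v \<Rightarrow> 'm). canonical d V R f \<and> G \<subseteq> R \<and>
      sat (saturated.canonical_team d R f) \<phi> \<and>
      (\<forall>F. finite F \<longrightarrow> F \<subseteq> R \<longrightarrow> (\<exists>H. extends D (Atom ` \<Sigma>) H \<and> F \<subseteq> H))"
    if G: "extends D (Atom ` \<Sigma>) G" "finite G" "vars_of G \<subseteq> V" for G
  proof -
    obtain R where R: "saturated d V R" "G \<subseteq> R"
      "\<And>F. finite F \<Longrightarrow> F \<subseteq> R \<Longrightarrow> \<exists>H. extends D G H \<and> F \<subseteq> H"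
      using saturation[of V D d G] V G \<open>finite D\<close> d by blast
    interpret saturated d V R
      by (fact R)
    obtain f :: "'v \<Rightarrow> 'm" where "\<And>a b. a \<in> V \<Longrightarrow> b \<in> V \<Longrightarrow> f a = f b \<longleftrightarrow> equ a b"
      using equ_classes V by blast
    then interpret canonical d V R f
      by unfold_locales
    have "Atom ` \<Sigma> \<subseteq> R"
      using R(2) extends_subset[OF G(1)] by blast
    then have "\<forall>\<psi>\<in>\<Sigma>. sat (canonical_team f) \<psi>"
      using assms(2) d by (auto simp: D_def intro!: sat_if_mem)
    then have "sat (canonical_team f) \<phi>"
      using assms(3) team_canonical_team[of f] d unfolding entails_def D_def
      by (metis UNIV_not_empty order_refl)
    moreover have "\<exists>H. extends D (Atom ` \<Sigma>) H \<and> F \<subseteq> H" if "finite F" "F \<subseteq> R" for F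
      using R(3)[OF that] extends_trans[OF _ G(1)] by blast
    ultimately show ?thesis
      using R(2) canonical_axioms by (intro exI[of _ R] exI[of _ f]) simp
  qed
  have start: "finite (Atom ` \<Sigma>)" "vars_of (Atom ` \<Sigma>) \<subseteq> D"
    using assms(1) by (auto simp: D_def)
  have \<phi>_D: "atom_vars \<phi> \<subseteq> D"
    by (auto simp: D_def)
  show ?thesis
  proof (cases \<phi>)
    case (Incl xs ys)
    have sub: "set xs \<subseteq> set d" "set ys \<subseteq> set d"
      using \<phi>_D Incl d by auto
    obtain R and f :: "'v \<Rightarrow> 'm" where R: "canonical d V R f"
      "sat (saturated.canonical_team d R f) \<phi>"
      "\<forall>F. finite F \<longrightarrow> F \<subseteq> R \<longrightarrow> (\<exists>H. extends D (Atom ` \<Sigma>) H \<and> F \<subseteq> H)"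
      using saturated_sat[OF extends.self start(1)] start(2) V(3) by blast
    have "Atom (Incl xs ys) \<in> R"
      using canonical.sat_Incl_imp_mem[OF R(1)] R(2) Incl sub by blast
    then obtain H where H: "extends D (Atom ` \<Sigma>) H" "Atom (Incl xs ys) \<in> H"
      using R(3)[rule_format, of "{Atom (Incl xs ys)}"] by auto
    \<comment> \<open>\<open>\<phi>\<close> is already in \<open>H\<close> but has to come last; a
      conjunction is introduced and eliminated to infer it again.\<close>
    have "infers (insert (And (Atom \<phi>) (Atom \<phi>)) H) (Atom \<phi>) {}"
      by (rule infers.conj_elim1[of _ "Atom \<phi>"]) simp
    moreover have "extends D (Atom ` \<Sigma>) (insert (And (Atom \<phi>) (Atom \<phi>)) H)"
      using H Incl by (auto intro!: extends.step[OF H(1)] infers.conj_intro)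
    ultimately show ?thesis
      using derives_if_extends \<phi>_D by blast
  next
    case (Indep bs as cs)
    have sub: "set as \<subseteq> set d" "set bs \<subseteq> set d" "set cs \<subseteq> set d"
      using \<phi>_D Indep d by auto
    have "infinite (V - D)"
      using V \<open>finite D\<close> by simp
    then obtain xs where xs: "distinct xs" "length xs = length cs" "set xs \<subseteq> V - D"
      using infinite_distinct_list by blast
    let ?\<alpha> = "Atom (Incl (as @ cs) (as @ xs))" and ?\<beta> = "Atom (Indep bs as xs)"
      and ?\<gamma> = "Atom (Incl (as @ xs) (as @ cs))"
    \<comment> \<open>The Start Axiom is a single conjunction, taken apart here by one elimination
      per step.\<close>
    let ?G1 = "insert (And ?\<alpha> (And ?\<beta> ?\<gamma>)) (Atom ` \<Sigma>)"
    let ?G2 = "insert (And ?\<beta> ?\<gamma>) (insert ?\<alpha> ?G1)"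
    let ?G = "insert ?\<gamma> (insert ?\<beta> ?G2)"
    have "extends D (Atom ` \<Sigma>) ?G1"
    proof (rule extends_step[OF infers.start_axiom])
      show "set xs \<inter> (vars_of (Atom ` \<Sigma>) \<union> set as \<union> set bs \<union> set cs) = {}"
        using xs(3) start(2) sub d by blast
    qed (use xs in auto)
    then have "extends D (Atom ` \<Sigma>) (insert ?\<alpha> ?G1)"
      by (rule extends.step) (auto intro: infers.conj_elim1)
    then have "extends D (Atom ` \<Sigma>) ?G2"
      by (rule extends.step) (auto intro: infers.conj_elim2)
    then have "extends D (Atom ` \<Sigma>) (insert ?\<beta> ?G2)"
      by (rule extends.step) (auto intro: infers.conj_elim1)
    then have ext: "extends D (Atom ` \<Sigma>) ?G"
      by (rule extends.step) (auto intro: infers.conj_elim2)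
    have "finite ?G" "vars_of ?G \<subseteq> V"
      using start sub xs(3) V(3) d by auto
    from saturated_sat[OF ext this] obtain R and f :: "'v \<Rightarrow> 'm" where R: "canonical d V R f"
      "?G \<subseteq> R" "sat (saturated.canonical_team d R f) \<phi>"
      "\<forall>F. finite F \<longrightarrow> F \<subseteq> R \<longrightarrow> (\<exists>H. extends D (Atom ` \<Sigma>) H \<and> F \<subseteq> H)"
      by (elim exE conjE) (rule that)
    \<comment> \<open>The third premise of the Final Rule. The other two are
      \<open>?\<alpha>\<close> and \<open>?\<beta>\<close>, while \<open>?\<gamma>\<close> serves to
      obtain this one.\<close>
    let ?\<delta> = "Atom (Incl (as @ bs @ xs) (as @ bs @ cs))"
    have "?\<gamma> \<in> R"
      using R(2) by blast
    then have "?\<delta> \<in> R"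
      using canonical.sat_Indep_imp_mem[OF R(1) _ sub] R(3) xs(2) unfolding Indep by blast
    then have "{?\<alpha>, ?\<beta>, ?\<delta>} \<subseteq> R"
      using R(2) by blast
    then obtain H where H: "extends D (Atom ` \<Sigma>) H" "{?\<alpha>, ?\<beta>, ?\<delta>} \<subseteq> H"
      using R(4)[rule_format, of "{?\<alpha>, ?\<beta>, ?\<delta>}"] by blast
    have "infers H (Atom \<phi>) {}"
      unfolding Indep using H(2) by (intro infers.final[of as cs xs]) auto
    then show ?thesis
      using derives_if_extends[OF H(1)] \<phi>_D by blast
  qed
qed

end
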